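(* Let $S$ be an insertion-only stream of edges of an underlying graph $G$ on a fixed vertex set $V$ with $|V|=n$, and let $k\in\mathbb{N}$. There exists a deterministic $(k^2,2^{2k^2})$-PSA for the $VC(k)$ problem. That is, there is a deterministic algorithm that makes one pass over $S$, maintains a sketch using $\tilde{O}(k^2)$ space, and at every time $i$ can, in time $\tilde{O}(2^{2k^2})$, using only the sketch, either output a vertex cover of size at most $k$ of the graph formed by the first $i$ edges of $S$, or correctly report that this graph has no vertex cover of size at most $k$.
   Context: A vertex cover of an undirected graph $G=(V,E)$ is a set $C\subseteq V$ such that every edge has at least one endpoint in $C$. The parameterized Vertex Cover problem $VC(k)$: given a graph $G$ and $k\in\mathbb{N}$, either return a vertex cover of size at most $k$ or report that none exists. In an insertion-only stream $S$ the $i$-th element is an edge inserted at time $i$; the input at time $i$ is the set of edges inserted up to time $i$. Let $m$ denote the number of edges; $\tilde{O}(f(k))$ means $O(f(k)\cdot \log^{O(1)} m)$. An $(f(k),g(k))$-PSA (parameterized streaming algorithm) is an algorithm that computes a sketch (a sublinear-space data structure supporting a fixed set of updates and queries) using $\tilde{O}(f(k))$ space in one pass over the stream, such that at any time $i$ it extracts from the sketch, in time $\tilde{O}(g(k))$, a solution of size at most $k$ for the current input or reports that no such solution exists. *)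

theory Defs
  imports Complex_Main
begin

subsection \<open>Graphs, vertex covers and insertion-only streams\<close>

definition vertex_cover :: "nat set \<Rightarrow> nat set set \<Rightarrow> nat set \<Rightarrow> bool" where
  "vertex_cover V E C \<longleftrightarrow> C \<subseteq> V \<and> (\<forall>e\<in>E. e \<inter> C \<noteq> {})"

text \<open>
  The vertex set is \<open>{..<n}\<close>. A stream lists undirected edges; each is presented as a pair,
  in an arbitrary orientation. Repeated insertions are allowed, as the input at
  time \<open>i\<close> is by definition the set of edges inserted so far.
\<close>

type_synonym stream = "(nat \<times> nat) list"

definition edge_stream :: "nat \<Rightarrow> stream \<Rightarrow> bool" where
  "edge_stream n S \<longleftrightarrow> (\<forall>(u, v)\<in>set S. u < n \<and> v < n \<and> u \<noteq> v)"

definition edges :: "stream \<Rightarrow> nat set set" where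
  "edges S = {{u, v} | u v. (u, v) \<in> set S}"


subsection \<open>A word RAM\<close>

text \<open>
  Programs run on a memory of \<open>s\<close> words of \<open>w\<close> bits each. There are no other registers, so
  \<open>s\<close> accounts for all space in use. A program that accesses an address
  \<open>\<ge> s\<close> or computes a value \<open>\<ge> 2 ^ w\<close> is stuck, i.e. has no execution.
\<close>

type_synonym mem = "nat \<Rightarrow> nat"

definition is_mem :: "nat \<Rightarrow> nat \<Rightarrow> mem \<Rightarrow> bool" where
  "is_mem s w \<sigma> \<longleftrightarrow> (\<forall>a<s. \<sigma> a < 2 ^ w) \<and> (\<forall>a\<ge>s. \<sigma> a = 0)"

datatype binop = Add | Sub | Mul | Div | Mod | Less | Eq

datatype aexp = Const nat | Read aexp | Bin binop aexp aexp

datatype com =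
    Skip
  | Write aexp aexp
  | Seq com com
  | If aexp com com
  | While aexp com

fun bval :: "binop \<Rightarrow> nat \<Rightarrow> nat \<Rightarrow> nat" where
  "bval Add x y = x + y"
| "bval Sub x y = x - y"
| "bval Mul x y = x * y"
| "bval Div x y = x div y"
| "bval Mod x y = x mod y"
| "bval Less x y = (if x < y then 1 else 0)"
| "bval Eq x y = (if x = y then 1 else 0)"

fun aval :: "aexp \<Rightarrow> mem \<Rightarrow> nat" where
  "aval (Const x) \<sigma> = x"
| "aval (Read e) \<sigma> = \<sigma> (aval e \<sigma>)"
| "aval (Bin f e1 e2) \<sigma> = bval f (aval e1 \<sigma>) (aval e2 \<sigma>)"

fun fits :: "nat \<Rightarrow> nat \<Rightarrow> aexp \<Rightarrow> mem \<Rightarrow> bool" where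
  "fits s w (Const x) \<sigma> \<longleftrightarrow> x < 2 ^ w"
| "fits s w (Read e) \<sigma> \<longleftrightarrow> fits s w e \<sigma> \<and> aval e \<sigma> < s"
| "fits s w (Bin f e1 e2) \<sigma> \<longleftrightarrow>
     fits s w e1 \<sigma> \<and> fits s w e2 \<sigma> \<and> bval f (aval e1 \<sigma>) (aval e2 \<sigma>) < 2 ^ w"

fun ops :: "aexp \<Rightarrow> nat" where
  "ops (Const x) = 1"
| "ops (Read e) = 1 + ops e"
| "ops (Bin f e1 e2) = 1 + ops e1 + ops e2"

text \<open>
  \<open>exec s w c \<sigma> t \<tau>\<close>: started in memory \<open>\<sigma>\<close>, the program \<open>c\<close> halts after \<open>t\<close> unit-cost
  operations in memory \<open>\<tau>\<close>. Conditions are true iff nonzero.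
\<close>

inductive exec :: "nat \<Rightarrow> nat \<Rightarrow> com \<Rightarrow> mem \<Rightarrow> nat \<Rightarrow> mem \<Rightarrow> bool" for s w :: nat where
  Skip: "exec s w Skip \<sigma> 1 \<sigma>"
| Write: "\<lbrakk>fits s w a \<sigma>; fits s w e \<sigma>; aval a \<sigma> < s\<rbrakk>
    \<Longrightarrow> exec s w (Write a e) \<sigma> (1 + ops a + ops e) (\<sigma>(aval a \<sigma> := aval e \<sigma>))"
| Seq: "\<lbrakk>exec s w c1 \<sigma> t1 \<rho>; exec s w c2 \<rho> t2 \<tau>\<rbrakk> \<Longrightarrow> exec s w (Seq c1 c2) \<sigma> (t1 + t2) \<tau>"
| IfTrue: "\<lbrakk>fits s w b \<sigma>; aval b \<sigma> \<noteq> 0; exec s w c1 \<sigma> t \<tau>\<rbrakk>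
    \<Longrightarrow> exec s w (If b c1 c2) \<sigma> (1 + ops b + t) \<tau>"
| IfFalse: "\<lbrakk>fits s w b \<sigma>; aval b \<sigma> = 0; exec s w c2 \<sigma> t \<tau>\<rbrakk>
    \<Longrightarrow> exec s w (If b c1 c2) \<sigma> (1 + ops b + t) \<tau>"
| WhileFalse: "\<lbrakk>fits s w b \<sigma>; aval b \<sigma> = 0\<rbrakk> \<Longrightarrow> exec s w (While b c) \<sigma> (1 + ops b) \<sigma>"
| WhileTrue: "\<lbrakk>fits s w b \<sigma>; aval b \<sigma> \<noteq> 0; exec s w c \<sigma> t1 \<rho>; exec s w (While b c) \<rho> t2 \<tau>\<rbrakk>
    \<Longrightarrow> exec s w (While b c) \<sigma> (1 + ops b + t1 + t2) \<tau>"

inductive_cases SkipE: "exec s w Skip \<sigma> t \<tau>"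
inductive_cases WriteE: "exec s w (Write a e) \<sigma> t \<tau>"
inductive_cases SeqE: "exec s w (Seq c1 c2) \<sigma> t \<tau>"
inductive_cases IfE: "exec s w (If b c1 c2) \<sigma> t \<tau>"
inductive_cases WhileE: "exec s w (While b c) \<sigma> t \<tau>"

lemma exec_deterministic:
  "exec s w c \<sigma> t \<tau> \<Longrightarrow> exec s w c \<sigma> t' \<tau>' \<Longrightarrow> t' = t \<and> \<tau>' = \<tau>"
proof (induction arbitrary: t' \<tau>' rule: exec.induct)
  case (Skip \<sigma>)
  from Skip.prems show ?case by (rule SkipE) auto
next
  case (Write a \<sigma> e)
  from Write.prems show ?case by (rule WriteE) auto
next
  case (Seq c1 \<sigma> t1 \<rho> c2 t2 \<tau>)
  from Seq.prems obtain r1 \<rho>' r2 where *: "t' = r1 + r2"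
      "exec s w c1 \<sigma> r1 \<rho>'" "exec s w c2 \<rho>' r2 \<tau>'"
    by (rule SeqE)
  from Seq.IH(1)[OF *(2)] *(3) have "r1 = t1" "exec s w c2 \<rho> r2 \<tau>'" by simp_all
  with *(1) Seq.IH(2)[OF this(2)] show ?case by simp
next
  case (IfTrue b \<sigma> c1 t \<tau> c2)
  from IfTrue.prems show ?case
    by (rule IfE) (use IfTrue.hyps in \<open>auto dest: IfTrue.IH\<close>)
next
  case (IfFalse b \<sigma> c2 t \<tau> c1)
  from IfFalse.prems show ?case
    by (rule IfE) (use IfFalse.hyps in \<open>auto dest: IfFalse.IH\<close>)
next
  case (WhileFalse b \<sigma> c)
  from WhileFalse.prems show ?case
    by (rule WhileE) (use WhileFalse.hyps in auto)
next
  case (WhileTrue b \<sigma> c t1 \<rho> t2 \<tau>)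
  from WhileTrue.prems WhileTrue.hyps(2) obtain r1 \<rho>' r2 where *: "t' = 1 + ops b + r1 + r2"
      "exec s w c \<sigma> r1 \<rho>'" "exec s w (While b c) \<rho>' r2 \<tau>'"
    by (auto elim: WhileE)
  from WhileTrue.IH(1)[OF *(2)] *(3)
  have "r1 = t1" "exec s w (While b c) \<rho> r2 \<tau>'" by simp_all
  with *(1) WhileTrue.IH(2)[OF this(2)] show ?case by simp
qed


subsection \<open>Parameterized streaming algorithms\<close>

record stream_alg =
  init :: com
  update :: com
  query :: com

text \<open>
  \<open>sketch s w A n k S \<sigma>\<close>: after one pass over \<open>S\<close> the memory contents are \<open>\<sigma>\<close>. Cells \<open>0\<close> and
  \<open>1\<close> are input ports: they hold \<open>n\<close> and \<open>k\<close> at the start, and the end points of the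
  inserted edge at each update.
\<close>

inductive sketch ::
  "nat \<Rightarrow> nat \<Rightarrow> stream_alg \<Rightarrow> nat \<Rightarrow> nat \<Rightarrow> stream \<Rightarrow> mem \<Rightarrow> bool"
  for s w :: nat and A :: stream_alg and n k :: nat
where
  start: "\<lbrakk>\<sigma> = (\<lambda>_. 0)(0 := n, 1 := k); is_mem s w \<sigma>; exec s w (init A) \<sigma> t \<tau>\<rbrakk>
    \<Longrightarrow> sketch s w A n k [] \<tau>"
| insert: "\<lbrakk>sketch s w A n k S \<rho>; \<sigma> = \<rho>(0 := u, 1 := v); is_mem s w \<sigma>;
     exec s w (update A) \<sigma> t \<tau>\<rbrakk>
    \<Longrightarrow> sketch s w A n k (S @ [(u, v)]) \<tau>"

text \<open>
  The answer left in memory by a query: cell \<open>0\<close> is zero for ``no solution''; otherwise the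
  solution is stored in the array with start address in cell \<open>1\<close> and length in cell \<open>2\<close>.
\<close>

definition answer :: "mem \<Rightarrow> nat set option" where
  "answer \<tau> = (if \<tau> 0 = 0 then None else Some (\<tau> ` {\<tau> 1..<\<tau> 1 + \<tau> 2}))"

definition correct_answer ::
  "(nat set \<Rightarrow> nat set set \<Rightarrow> nat set \<Rightarrow> bool) \<Rightarrow> nat \<Rightarrow> nat \<Rightarrow> nat set \<Rightarrow> nat set set \<Rightarrow> mem \<Rightarrow> bool"
where
  "correct_answer sol s k V E \<tau> \<longleftrightarrow>
     (case answer \<tau> of
        None \<Rightarrow> \<not> (\<exists>X. sol V E X \<and> finite X \<and> card X \<le> k)
      | Some X \<Rightarrow> \<tau> 1 + \<tau> 2 \<le> s \<and> sol V E X \<and> card X \<le> k)"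

text \<open>
  The bound \<open>C \<cdot> x \<cdot> (log m)\<^sup>c\<close> hidden in the soft-O notation. The two maxima only matter in the
  degenerate cases \<open>x < 1\<close> and \<open>m < 2\<close>, where the plain expression can vanish.
\<close>

definition soft_bound :: "real \<Rightarrow> nat \<Rightarrow> real \<Rightarrow> nat \<Rightarrow> real" where
  "soft_bound C c x m = C * max 1 x * max 1 (log 2 (real m)) ^ c"

text \<open>
  Space is counted in words of \<open>O(log (n + k))\<close> bits, the length needed to hold a vertex name
  and the parameter.
\<close>

definition word_len :: "nat \<Rightarrow> nat \<Rightarrow> nat \<Rightarrow> nat" where
  "word_len d n k = d * nat \<lceil>log 2 (real (n + k + 2))\<rceil>"

text \<open>
  The three programs are fixed once and for all and serve all \<open>n\<close>, \<open>k\<close> and \<open>S\<close>. A query is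
  run on the sketch alone, and within the same memory of \<open>s\<close> words; its effect on the memory is
  discarded when the stream continues. The time of an update is not restricted.
\<close>

definition is_PSA ::
  "(nat \<Rightarrow> real) \<Rightarrow> (nat \<Rightarrow> real) \<Rightarrow> (nat set \<Rightarrow> nat set set \<Rightarrow> nat set \<Rightarrow> bool)
    \<Rightarrow> stream_alg \<Rightarrow> bool"
where
  "is_PSA f g sol A \<longleftrightarrow>
     (\<exists>C c d. \<forall>n k S. edge_stream n S \<longrightarrow>
       (let m = card (edges S); w = word_len d n k in
        \<exists>s. real s \<le> soft_bound C c (f k) m \<and>
          (\<forall>i\<le>length S. \<exists>\<sigma> t \<tau>.
             sketch s w A n k (take i S) \<sigma> \<and>
             exec s w (query A) \<sigma> t \<tau> \<and>
             real t \<le> soft_bound C c (g k) m \<and>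
             correct_answer sol s k {..<n} (edges (take i S)) \<tau>)))"

end

theory Submission
  imports Defs "HOL-Library.Nat_Bijection"
begin

text \<open>
  The sketch is a set of edges in which every vertex has degree at most \<open>k + 1\<close>: an edge is
  dropped if one of its end points already has degree \<open>k + 1\<close>, or once \<open>k\<^sup>2 + k + 1\<close> edges are
  stored. A cover of the stored edges of size at most \<open>k\<close> contains every vertex of degree
  greater than \<open>k\<close>, so it also covers the edges dropped for the first reason; and \<open>k\<close> vertices of
  degree at most \<open>k + 1\<close> cover at most \<open>k\<^sup>2 + k\<close> edges, so a full sketch certifies that there is
  no solution. A query runs through all ways to choose one end point of each stored edge, as a
  binary counter, until at most \<open>k\<close> distinct vertices are chosen. This takes time
  \<open>2 ^ (k\<^sup>2 + k + 1)\<close> times a polynomial in \<open>k\<close>, which is \<open>O(2 ^ (2 * k\<^sup>2))\<close>.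
\<close>

section \<open>A timed weakest-precondition calculus\<close>

text \<open>An existential suffices for total correctness: a halting run is unique by
  \<open>exec_deterministic\<close>, and a stuck or diverging program has none. The postcondition
  sees the running time, so correctness and cost are proved together.\<close>

definition wp :: "nat \<Rightarrow> nat \<Rightarrow> com \<Rightarrow> (nat \<Rightarrow> mem \<Rightarrow> bool) \<Rightarrow> mem \<Rightarrow> bool" where
  "wp s w c Q \<sigma> \<longleftrightarrow> (\<exists>t \<tau>. exec s w c \<sigma> t \<tau> \<and> Q t \<tau>)"

lemma wp_Skip [simp]: "wp s w Skip Q \<sigma> \<longleftrightarrow> Q 1 \<sigma>"
  unfolding wp_def by (metis SkipE exec.Skip)

lemma wp_Write [simp]:
  "wp s w (Write a e) Q \<sigma> \<longleftrightarrow> fits s w a \<sigma> \<and> fits s w e \<sigma> \<and> aval a \<sigma> < s \<and>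
     Q (1 + ops a + ops e) (\<sigma>(aval a \<sigma> := aval e \<sigma>))"
  unfolding wp_def by (auto elim!: WriteE intro!: exec.Write exI)

lemma wp_Seq [simp]:
  "wp s w (Seq c1 c2) Q \<sigma> \<longleftrightarrow> wp s w c1 (\<lambda>t. wp s w c2 (\<lambda>t'. Q (t + t'))) \<sigma>"
  unfolding wp_def by (blast elim: SeqE intro: exec.Seq)

lemma wp_If [simp]:
  "wp s w (If b c1 c2) Q \<sigma> \<longleftrightarrow> fits s w b \<sigma> \<and>
     (if aval b \<sigma> \<noteq> 0 then wp s w c1 (\<lambda>t. Q (1 + ops b + t)) \<sigma>
      else wp s w c2 (\<lambda>t. Q (1 + ops b + t)) \<sigma>)"
  unfolding wp_def
  by (cases "aval b \<sigma> = 0") (force elim: IfE intro: exec.IfTrue exec.IfFalse)+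

lemma wp_mono: "wp s w c Q \<sigma> \<Longrightarrow> (\<And>t \<tau>. Q t \<tau> \<Longrightarrow> Q' t \<tau>) \<Longrightarrow> wp s w c Q' \<sigma>"
  unfolding wp_def by blast

text \<open>The variant is an argument of the invariant and drops by one per round, so it bounds the
  number of rounds. Each round costs at most \<open>D\<close> including its test; the final failing
  test accounts for the \<open>+ 1\<close>.\<close>

lemma wp_While:
  assumes "I n \<sigma>"
    and fits: "\<And>n \<rho>. I n \<rho> \<Longrightarrow> fits s w b \<rho>"
    and body: "\<And>n \<rho>. I n \<rho> \<Longrightarrow> aval b \<rho> \<noteq> 0 \<Longrightarrow>
      n > 0 \<and> wp s w c (\<lambda>t \<tau>. 1 + ops b + t \<le> D \<and> I (n - 1) \<tau>) \<rho>"
    and D: "1 + ops b \<le> D"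
  shows "wp s w (While b c) (\<lambda>t \<tau>. t \<le> (n + 1) * D \<and> aval b \<tau> = 0 \<and> (\<exists>m. I m \<tau>)) \<sigma>"
  using assms(1)
proof (induction n arbitrary: \<sigma>)
  case 0
  with body have b: "aval b \<sigma> = 0" by blast
  with exec.WhileFalse[OF fits[OF 0] b] 0 D show ?case
    unfolding wp_def by (intro exI conjI) auto
next
  case (Suc n)
  show ?case
  proof (cases "aval b \<sigma> = 0")
    case True
    with exec.WhileFalse[OF fits[OF Suc.prems] True] Suc.prems D show ?thesis
      unfolding wp_def by (intro exI conjI) auto
  next
    case False
    with body[OF Suc.prems] obtain t \<rho> where t: "exec s w c \<sigma> t \<rho>" "1 + ops b + t \<le> D" "I n \<rho>"
      unfolding wp_def by auto
    from Suc.IH[OF t(3)] obtain t' \<tau> where t': "exec s w (While b c) \<rho> t' \<tau>"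
      "t' \<le> (n + 1) * D" "aval b \<tau> = 0 \<and> (\<exists>m. I m \<tau>)"
      unfolding wp_def by auto
    have "1 + ops b + t + t' \<le> (Suc n + 1) * D" using t(2) t'(2) by simp
    with exec.WhileTrue[OF fits[OF Suc.prems] False t(1) t'(1)] t'(3) show ?thesis
      unfolding wp_def by blast
  qed
qed

text \<open>\<open>fits\<close> bounds constants and results of operations explicitly; a value that
  is read is bounded only because every cell holds \<open>w\<close> bits.\<close>

lemma aval_less_if_fits: "is_mem s w \<sigma> \<Longrightarrow> fits s w e \<sigma> \<Longrightarrow> aval e \<sigma> < 2 ^ w"
  by (cases e) (auto simp: is_mem_def)

lemma exec_is_mem: "exec s w c \<sigma> t \<tau> \<Longrightarrow> is_mem s w \<sigma> \<Longrightarrow> is_mem s w \<tau>"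
proof (induction rule: exec.induct)
  case (Write a \<sigma> e)
  with aval_less_if_fits[OF Write.prems Write.hyps(2)] show ?case
    by (auto simp: is_mem_def)
qed auto


section \<open>The programs\<close>

abbreviation cell :: "nat \<Rightarrow> aexp" where "cell x \<equiv> Read (Const x)"

abbreviation "set_cell x e \<equiv> Write (Const x) e"

text \<open>
  Cell 2 holds \<open>k\<close>, cell 3 the capacity \<open>L = k\<^sup>2 + k + 1\<close>, cell 6 the number of stored edges.
  The \<open>i\<close>-th stored edge has end points in \<open>16 + L + i\<close> and \<open>16 + 2 * L + i\<close> (array bases in
  cells 4 and 5), and the end point currently chosen from it is in \<open>16 + i\<close>.
  Cells 7 to 12 are temporary.
\<close>

abbreviation "choice_addr i \<equiv> Bin Add (Const 16) (cell i)"
abbreviation "fst_addr i \<equiv> Bin Add (cell 4) (cell i)"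
abbreviation "snd_addr i \<equiv> Bin Add (cell 5) (cell i)"

definition vc_init :: com where
  "vc_init =
     Seq (set_cell 2 (cell 1))
    (Seq (set_cell 3 (Bin Add (Bin Mul (cell 2) (cell 2)) (Bin Add (cell 2) (Const 1))))
    (Seq (set_cell 4 (Bin Add (Const 16) (cell 3)))
         (set_cell 5 (Bin Add (cell 4) (cell 3)))))"

text \<open>Adding the two tests gives a 0/1 value only because the end points of a stored edge
  differ.\<close>

definition incident :: "nat \<Rightarrow> aexp" where
  "incident x =
     Bin Add (Bin Eq (Read (fst_addr 7)) (cell x)) (Bin Eq (Read (snd_addr 7)) (cell x))"

definition count_loop :: com where
  "count_loop = While (Bin Less (cell 7) (cell 6))
     (Seq (set_cell 9 (Bin Add (cell 9) (incident 0)))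
     (Seq (set_cell 10 (Bin Add (cell 10) (incident 1)))
     (Seq (set_cell 11 (Bin Add (cell 11) (Bin Mul (incident 0) (incident 1))))
          (set_cell 7 (Bin Add (cell 7) (Const 1))))))"

text \<open>Initialising the choice with the first end point puts the counter of the query at zero
  in every sketch.\<close>

definition store_edge :: com where
  "store_edge =
     Seq (Write (choice_addr 6) (cell 0))
    (Seq (Write (fst_addr 6) (cell 0))
    (Seq (Write (snd_addr 6) (cell 1))
         (set_cell 6 (Bin Add (cell 6) (Const 1)))))"

text \<open>The language has no Boolean operators: a product of 0/1 values stands for conjunction,
  comparison with 0 for negation.\<close>

definition vc_update :: com where
  "vc_update =
     Seq (set_cell 7 (Const 0))
    (Seq (set_cell 9 (Const 0))
    (Seq (set_cell 10 (Const 0))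
    (Seq (set_cell 11 (Const 0))
    (Seq count_loop
    (If (Bin Mul (Bin Mul (Bin Eq (Bin Less (cell 2) (cell 9)) (Const 0))
                          (Bin Eq (Bin Less (cell 2) (cell 10)) (Const 0)))
                 (Bin Mul (Bin Eq (cell 11) (Const 0)) (Bin Less (cell 6) (cell 3))))
        store_edge Skip)))))"

text \<open>No bound test is needed, since the position in cell 7 matches itself. Stopping there
  means that the chosen vertex does not occur earlier.\<close>

definition find_loop :: com where
  "find_loop = While (Bin Eq (Bin Eq (Read (choice_addr 8)) (Read (choice_addr 7))) (Const 0))
     (set_cell 8 (Bin Add (cell 8) (Const 1)))"

definition distinct_loop :: com where
  "distinct_loop = While (Bin Less (cell 7) (cell 6))
     (Seq (set_cell 8 (Const 0))
     (Seq find_loop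
     (Seq (If (Bin Eq (cell 8) (cell 7)) (set_cell 9 (Bin Add (cell 9) (Const 1))) Skip)
          (set_cell 7 (Bin Add (cell 7) (Const 1))))))"

text \<open>Second end points act as digit 1, first ones as digit 0, with the least significant
  digit at index 0. The guard evaluates both factors, so it reads the arrays even at index
  \<open>c\<close>, which for \<open>c = L\<close> is one past the end; hence the extra cell in
  \<open>17 + 3 * L\<close>.\<close>

definition carry_loop :: com where
  "carry_loop = While (Bin Mul (Bin Less (cell 7) (cell 6))
       (Bin Eq (Read (choice_addr 7)) (Read (snd_addr 7))))
     (Seq (Write (choice_addr 7) (Read (fst_addr 7)))
          (set_cell 7 (Bin Add (cell 7) (Const 1))))"

definition next_choice :: com where
  "next_choice =
     Seq (set_cell 7 (Const 0))
    (Seq carry_loop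
         (If (Bin Less (cell 7) (cell 6))
             (Write (choice_addr 7) (Read (snd_addr 7)))
             (set_cell 11 (Const 0))))"

definition search_loop :: com where
  "search_loop = While (cell 11)
     (Seq (set_cell 9 (Const 0))
     (Seq (set_cell 7 (Const 0))
     (Seq distinct_loop
          (If (Bin Less (cell 2) (cell 9))
              next_choice
              (Seq (set_cell 12 (Const 1)) (set_cell 11 (Const 0)))))))"

text \<open>The choice array itself is the answer; repeated vertices disappear because an answer is
  a set. Overwriting \<open>k\<close> in cell 2 is harmless, since the effect of a query is
  discarded.\<close>

definition vc_query :: com where
  "vc_query =
     Seq (set_cell 12 (Const 0))
    (Seq (set_cell 11 (Const 1))
    (Seq search_loop
    (Seq (set_cell 0 (cell 12))
    (Seq (set_cell 1 (Const 16))
         (set_cell 2 (cell 6))))))"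


section \<open>Verification of the programs\<close>

text \<open>The choice array and the temporary cells are left out, so the predicate is preserved
  throughout the search. \<open>a\<close> and \<open>b\<close> name the stored end points on the
  logical level.\<close>

definition layout ::
  "nat \<Rightarrow> nat \<Rightarrow> nat \<Rightarrow> (nat \<Rightarrow> nat) \<Rightarrow> (nat \<Rightarrow> nat) \<Rightarrow> mem \<Rightarrow> bool" where
  "layout k L c a b \<sigma> \<longleftrightarrow> c \<le> L \<and>
     \<sigma> 2 = k \<and> \<sigma> 3 = L \<and> \<sigma> 4 = 16 + L \<and> \<sigma> 5 = 16 + 2 * L \<and> \<sigma> 6 = c \<and>
     (\<forall>i<c. \<sigma> (16 + L + i) = a i \<and> \<sigma> (16 + 2 * L + i) = b i)"

section \<open>Counting the distinct vertices of a choice\<close>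

lemma wp_find_loop:
  assumes "layout k L c a b \<sigma>" "\<sigma> 7 < c" "\<sigma> 8 = 0" "17 + 3 * L \<le> s" "s \<le> 2 ^ w"
  shows "wp s w find_loop (\<lambda>t \<tau>. t \<le> (c + 1) * 20 \<and>
    (\<exists>j\<le>\<sigma> 7. \<tau> = \<sigma>(8 := j) \<and> (j = \<sigma> 7 \<longleftrightarrow> \<sigma> (16 + \<sigma> 7) \<notin> (\<lambda>i. \<sigma> (16 + i)) ` {..<\<sigma> 7}))) \<sigma>"
proof -
  define I where "I m \<rho> \<longleftrightarrow> (\<exists>j\<le>\<sigma> 7. \<rho> = \<sigma>(8 := j) \<and> m = \<sigma> 7 - j \<and>
    (\<forall>i<j. \<sigma> (16 + i) \<noteq> \<sigma> (16 + \<sigma> 7)))" for m \<rho>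
  have W: "c \<le> L" "17 + 3 * L \<le> 2 ^ w" using assms by (auto simp: layout_def)
  have "wp s w find_loop (\<lambda>t \<tau>. t \<le> (\<sigma> 7 + 1) * 20 \<and>
      aval (Bin Eq (Bin Eq (Read (choice_addr 8)) (Read (choice_addr 7))) (Const 0)) \<tau> = 0
      \<and> (\<exists>m. I m \<tau>)) \<sigma>"
    unfolding find_loop_def
  proof (rule wp_While)
    show "I (\<sigma> 7) \<sigma>" using assms by (auto simp: I_def intro!: exI[of _ 0])
    show "fits s w (Bin Eq (Bin Eq (Read (choice_addr 8)) (Read (choice_addr 7))) (Const 0)) \<rho>"
      if "I n \<rho>" for n \<rho>
      using that W assms by (auto simp: I_def layout_def)
    show "0 < n \<and> wp s w (set_cell 8 (Bin Add (cell 8) (Const 1)))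
        (\<lambda>t \<tau>. 1 + ops (Bin Eq (Bin Eq (Read (choice_addr 8)) (Read (choice_addr 7))) (Const 0)) + t
               \<le> 20 \<and> I (n - 1) \<tau>) \<rho>"
      if inv: "I n \<rho>" and
        "aval (Bin Eq (Bin Eq (Read (choice_addr 8)) (Read (choice_addr 7))) (Const 0)) \<rho> \<noteq> 0"
      for n \<rho>
    proof -
      from inv obtain j where j: "j \<le> \<sigma> 7" "\<rho> = \<sigma>(8 := j)" "n = \<sigma> 7 - j"
        "\<forall>i<j. \<sigma> (16 + i) \<noteq> \<sigma> (16 + \<sigma> 7)" by (auto simp: I_def)
      with that(2) have ne: "\<sigma> (16 + j) \<noteq> \<sigma> (16 + \<sigma> 7)" by (auto split: if_splits)
      then have "j < \<sigma> 7" using j(1) by (cases "j = \<sigma> 7") auto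
      with j ne W assms show ?thesis
        by (auto simp: I_def layout_def less_Suc_eq intro!: exI[of _ "Suc j"])
    qed
  qed auto
  then show ?thesis
  proof (rule wp_mono, elim conjE exE)
    fix t \<tau> m
    assume t: "t \<le> (\<sigma> 7 + 1) * 20" and I: "I m \<tau>" and
      b: "aval (Bin Eq (Bin Eq (Read (choice_addr 8)) (Read (choice_addr 7))) (Const 0)) \<tau> = 0"
    from I obtain j where j: "j \<le> \<sigma> 7" "\<tau> = \<sigma>(8 := j)"
        "\<forall>i<j. \<sigma> (16 + i) \<noteq> \<sigma> (16 + \<sigma> 7)" by (auto simp: I_def)
    with b have eq: "\<sigma> (16 + j) = \<sigma> (16 + \<sigma> 7)" by (auto split: if_splits)
    have "j = \<sigma> 7 \<longleftrightarrow> \<sigma> (16 + \<sigma> 7) \<notin> (\<lambda>i. \<sigma> (16 + i)) ` {..<\<sigma> 7}"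
      using j eq by (metis (no_types, lifting) imageE image_eqI lessThan_iff nat_less_le)
    with t j assms(2) show "t \<le> (c + 1) * 20 \<and> (\<exists>j\<le>\<sigma> 7. \<tau> = \<sigma>(8 := j) \<and>
      (j = \<sigma> 7 \<longleftrightarrow> \<sigma> (16 + \<sigma> 7) \<notin> (\<lambda>i. \<sigma> (16 + i)) ` {..<\<sigma> 7}))"
      by auto
  qed
qed

lemma wp_distinct_loop:
  assumes "layout k L c a b \<sigma>" "\<sigma> 7 = 0" "\<sigma> 9 = 0" "17 + 3 * L \<le> s" "s \<le> 2 ^ w"
  shows "wp s w distinct_loop (\<lambda>t \<tau>. t \<le> (c + 1) * ((c + 1) * 20 + 50) \<and>
    (\<exists>x y. \<tau> = \<sigma>(7 := x, 8 := y, 9 := card ((\<lambda>i. \<sigma> (16 + i)) ` {..<c})))) \<sigma>"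
proof -
  let ?b = "Bin Less (cell 7) (cell 6)"
  let ?p = "\<lambda>i. \<sigma> (16 + i)"
  define I where "I m \<rho> \<longleftrightarrow> (\<exists>i\<le>c. \<exists>y. \<rho> = \<sigma>(7 := i, 8 := y, 9 := card (?p ` {..<i})) \<and>
    m = c - i)" for m \<rho>
  have W: "c \<le> L" "17 + 3 * L \<le> 2 ^ w" and c: "\<sigma> 6 = c" using assms by (auto simp: layout_def)
  have "wp s w distinct_loop (\<lambda>t \<tau>. t \<le> (c + 1) * ((c + 1) * 20 + 50) \<and>
      aval ?b \<tau> = 0 \<and> (\<exists>m. I m \<tau>)) \<sigma>"
    unfolding distinct_loop_def
  proof (rule wp_While)
    show "I c \<sigma>" unfolding I_def using assms
      by (intro exI[of _ 0] exI[of _ "\<sigma> 8"] conjI) (auto simp: fun_eq_iff)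
    show "fits s w ?b \<rho>" if "I n \<rho>" for n \<rho>
      using that W c assms(4) by (auto simp: I_def)
    fix n \<rho> assume "I n \<rho>" and b: "aval ?b \<rho> \<noteq> 0"
    then obtain i y where i: "i \<le> c" "\<rho> = \<sigma>(7 := i, 8 := y, 9 := card (?p ` {..<i}))" "n = c - i"
      by (auto simp: I_def)
    with b c have "i < c" by (auto split: if_splits)
    have card: "card (?p ` {..<i}) \<le> i" using card_image_le[of "{..<i}" ?p] by simp
    have img: "?p ` {..<Suc i} = insert (?p i) (?p ` {..<i})" by (simp add: lessThan_Suc)
    have p: "(\<rho>(8 := 0)) (16 + i) = ?p i" for i using i by simp
    have "wp s w find_loop (\<lambda>t \<tau>. t \<le> (c + 1) * 20 \<and>
      (\<exists>j\<le>i. \<tau> = \<sigma>(7 := i, 8 := j, 9 := card (?p ` {..<i})) \<and>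
        (j = i \<longleftrightarrow> ?p i \<notin> ?p ` {..<i}))) (\<rho>(8 := 0))"
    proof (rule wp_mono[OF wp_find_loop])
      show "layout k L c a b (\<rho>(8 := 0))" using assms i by (auto simp: layout_def)
    qed (use assms i \<open>i < c\<close> in \<open>auto simp: p fun_eq_iff\<close>)
    \<comment> \<open>The summand \<open>1 + 1 + 1\<close> is the cost of the preceding write
      \<open>set_cell 8 (Const 0)\<close>.\<close>
    then have "wp s w find_loop (\<lambda>t. wp s w
        (Seq (If (Bin Eq (cell 8) (cell 7)) (set_cell 9 (Bin Add (cell 9) (Const 1))) Skip)
          (set_cell 7 (Bin Add (cell 7) (Const 1))))
        (\<lambda>t' \<tau>. 1 + ops ?b + (1 + 1 + 1 + (t + t')) \<le> (c + 1) * 20 + 50 \<and> I (n - 1) \<tau>)) (\<rho>(8 := 0))"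
    proof (rule wp_mono, elim conjE exE)
      fix t \<tau> j
      assume *: "t \<le> (c + 1) * 20" "j \<le> i" "\<tau> = \<sigma>(7 := i, 8 := j, 9 := card (?p ` {..<i}))"
        "j = i \<longleftrightarrow> ?p i \<notin> ?p ` {..<i}"
      have "I (n - 1) (\<tau>(9 := card (?p ` {..<Suc i}), 7 := Suc i))"
        unfolding I_def using * \<open>i < c\<close> i
        by (intro exI[of _ "Suc i"] exI[of _ j] conjI) (auto simp: fun_eq_iff)
      moreover have "card (?p ` {..<Suc i}) = card (?p ` {..<i}) + (if j = i then 1 else 0)"
        unfolding img using *(4) by (auto simp: insert_absorb)
      ultimately show "wp s w
        (Seq (If (Bin Eq (cell 8) (cell 7)) (set_cell 9 (Bin Add (cell 9) (Const 1))) Skip)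
          (set_cell 7 (Bin Add (cell 7) (Const 1))))
        (\<lambda>t' \<tau>. 1 + ops ?b + (1 + 1 + 1 + (t + t')) \<le> (c + 1) * 20 + 50 \<and> I (n - 1) \<tau>) \<tau>"
        using * W card \<open>i < c\<close> assms(4) by (auto simp: fun_upd_twist)
    qed
    then show "0 < n \<and> wp s w (Seq (set_cell 8 (Const 0))
     (Seq find_loop
     (Seq (If (Bin Eq (cell 8) (cell 7)) (set_cell 9 (Bin Add (cell 9) (Const 1))) Skip)
          (set_cell 7 (Bin Add (cell 7) (Const 1))))))
       (\<lambda>t \<tau>. 1 + ops ?b + t \<le> (c + 1) * 20 + 50 \<and> I (n - 1) \<tau>) \<rho>"
      using i \<open>i < c\<close> W assms(4) by (simp del: wp_If)
  qed auto
  then show ?thesis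
  proof (rule wp_mono, elim conjE exE)
    fix t \<tau> m
    assume t: "t \<le> (c + 1) * ((c + 1) * 20 + 50)" and I: "I m \<tau>" and b: "aval ?b \<tau> = 0"
    from I obtain i y where i: "i \<le> c" "\<tau> = \<sigma>(7 := i, 8 := y, 9 := card (?p ` {..<i}))"
      by (auto simp: I_def)
    with b c have "i = c" by (auto split: if_splits)
    with t i show "t \<le> (c + 1) * ((c + 1) * 20 + 50) \<and>
      (\<exists>x y. \<tau> = \<sigma>(7 := x, 8 := y, 9 := card (?p ` {..<c})))" by blast
  qed
qed

section \<open>Stepping through the choices as a binary counter\<close>

lemma wp_carry_loop:
  assumes "layout k L c a b \<sigma>" "\<sigma> 7 = 0" "17 + 3 * L \<le> s" "s \<le> 2 ^ w"
  shows "wp s w carry_loop (\<lambda>t \<tau>. t \<le> (c + 1) * 50 \<and> layout k L c a b \<tau> \<and>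
    \<tau> 12 = \<sigma> 12 \<and> \<tau> 11 = \<sigma> 11 \<and> \<tau> 7 \<le> c \<and>
    (\<forall>j<\<tau> 7. \<sigma> (16 + j) = b j \<and> \<tau> (16 + j) = a j) \<and>
    (\<forall>j<c. \<tau> 7 \<le> j \<longrightarrow> \<tau> (16 + j) = \<sigma> (16 + j)) \<and>
    (\<tau> 7 < c \<longrightarrow> \<sigma> (16 + \<tau> 7) \<noteq> b (\<tau> 7))) \<sigma>"
proof -
  let ?b = "Bin Mul (Bin Less (cell 7) (cell 6))
       (Bin Eq (Read (choice_addr 7)) (Read (snd_addr 7)))"
  define I where "I m \<rho> \<longleftrightarrow> layout k L c a b \<rho> \<and> m = c - \<rho> 7 \<and>
    \<rho> 12 = \<sigma> 12 \<and> \<rho> 11 = \<sigma> 11 \<and> \<rho> 7 \<le> c \<and>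
    (\<forall>j<\<rho> 7. \<sigma> (16 + j) = b j \<and> \<rho> (16 + j) = a j) \<and>
    (\<forall>j<c. \<rho> 7 \<le> j \<longrightarrow> \<rho> (16 + j) = \<sigma> (16 + j))" for m \<rho>
  have W: "c \<le> L" "17 + 3 * L \<le> 2 ^ w" using assms by (auto simp: layout_def)
  have "wp s w carry_loop (\<lambda>t \<tau>. t \<le> (c + 1) * 50 \<and>
      aval ?b \<tau> = 0 \<and> (\<exists>m. I m \<tau>)) \<sigma>"
    unfolding carry_loop_def
  proof (rule wp_While)
    show "I c \<sigma>" using assms by (auto simp: I_def)
    show "fits s w ?b \<rho>" if "I n \<rho>" for n \<rho>
      using that W assms(3) by (auto simp: I_def layout_def)
    fix n \<rho> assume I: "I n \<rho>" and b: "aval ?b \<rho> \<noteq> 0"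
    then have "\<rho> 7 < c" "\<rho> (16 + \<rho> 7) = b (\<rho> 7)" "\<sigma> (16 + \<rho> 7) = b (\<rho> 7)"
      by (auto simp: I_def layout_def split: if_splits)
    with I W assms(3) show "0 < n \<and> wp s w (Seq (Write (choice_addr 7) (Read (fst_addr 7)))
          (set_cell 7 (Bin Add (cell 7) (Const 1))))
       (\<lambda>t \<tau>. 1 + ops ?b + t \<le> 50 \<and> I (n - 1) \<tau>) \<rho>"
      by (auto simp: I_def layout_def less_Suc_eq)
  qed auto
  then show ?thesis
    by (rule wp_mono) (auto simp: I_def layout_def split: if_splits)
qed

lemma set_encode_lessThan: "Suc (set_encode {..<n}) = 2 ^ n"
  by (induction n) (auto simp: set_encode_def lessThan_Suc)

text \<open>Encoding is monotone under inclusion, and the full set has number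
  \<open>2 ^ n - 1\<close>. The bound makes \<open>2 ^ c\<close> minus the current number a variant
  of the search.\<close>

lemma set_encode_less:
  assumes "T \<subseteq> {..<n}"
  shows "set_encode T < 2 ^ n"
proof -
  have "set_encode T \<le> set_encode {..<n}"
    unfolding set_encode_def using assms by (intro sum_mono2) auto
  with set_encode_lessThan[of n] show ?thesis by simp
qed

text \<open>The run of ones below \<open>i\<close> is worth \<open>2 ^ i - 1\<close>; trading it for
  digit \<open>i\<close> adds exactly one.\<close>

lemma set_encode_carry:
  assumes "finite T" "{..<i} \<subseteq> T" "i \<notin> T"
  shows "set_encode (insert i (T - {..<i})) = Suc (set_encode T)"
proof -
  have "set_encode T = set_encode (T - {..<i}) + set_encode {..<i}"
    unfolding set_encode_def by (rule sum.subset_diff) (use assms in auto)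
  with set_encode_lessThan[of i] assms show ?thesis by (simp add: set_encode_insert)
qed

definition chosen :: "nat \<Rightarrow> (nat \<Rightarrow> nat) \<Rightarrow> mem \<Rightarrow> nat set" where
  "chosen c b \<sigma> = {i. i < c \<and> \<sigma> (16 + i) = b i}"

definition valid_choice :: "nat \<Rightarrow> (nat \<Rightarrow> nat) \<Rightarrow> (nat \<Rightarrow> nat) \<Rightarrow> mem \<Rightarrow> bool" where
  "valid_choice c a b \<sigma> \<longleftrightarrow> (\<forall>i<c. \<sigma> (16 + i) \<in> {a i, b i})"

lemma wp_next_choice:
  assumes "layout k L c a b \<sigma>" "valid_choice c a b \<sigma>" "\<forall>i<c. a i \<noteq> b i"
    "17 + 3 * L \<le> s" "s \<le> 2 ^ w"
  shows "wp s w next_choice (\<lambda>t \<tau>. t \<le> (c + 1) * 50 + 30 \<and> layout k L c a b \<tau> \<and>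
    valid_choice c a b \<tau> \<and> \<tau> 12 = \<sigma> 12 \<and>
    (\<tau> 11 = \<sigma> 11 \<and> set_encode (chosen c b \<tau>) = Suc (set_encode (chosen c b \<sigma>)) \<or>
     \<tau> 11 = 0 \<and> chosen c b \<sigma> = {..<c})) \<sigma>"
    (is "wp s w _ ?Q _")
proof -
  have W: "c \<le> L" "17 + 3 * L \<le> 2 ^ w" using assms by (auto simp: layout_def)
  have "layout k L c a b (\<sigma>(7 := 0))" using assms(1) by (auto simp: layout_def)
  note carry = wp_carry_loop[OF this _ assms(4,5), simplified]
  have "wp s w carry_loop (\<lambda>t. wp s w (If (Bin Less (cell 7) (cell 6))
             (Write (choice_addr 7) (Read (snd_addr 7)))
             (set_cell 11 (Const 0))) (\<lambda>t'. ?Q (1 + 1 + 1 + (t + t')))) (\<sigma>(7 := 0))"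
  proof (rule wp_mono[OF carry], elim conjE, goal_cases)
    case (1 t \<tau>)
    note lay = \<open>layout k L c a b \<tau>\<close>
    show ?case
    proof (cases "\<tau> 7 < c")
      case True
      let ?\<tau> = "\<tau>(16 + \<tau> 7 := b (\<tau> 7))"
      \<comment> \<open>The cleared digits really leave the set because \<open>a j\<close> and
        \<open>b j\<close> differ.\<close>
      have "chosen c b ?\<tau> = insert (\<tau> 7) (chosen c b \<sigma> - {..<\<tau> 7})"
        using 1 True assms(3) by (auto simp: chosen_def)
      moreover have "{..<\<tau> 7} \<subseteq> chosen c b \<sigma>" "\<tau> 7 \<notin> chosen c b \<sigma>"
        using 1 True by (auto simp: chosen_def)
      moreover have "finite (chosen c b \<sigma>)" by (auto simp: chosen_def)
      ultimately have "set_encode (chosen c b ?\<tau>) = Suc (set_encode (chosen c b \<sigma>))"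
        by (metis set_encode_carry)
      moreover have "valid_choice c a b ?\<tau>"
        unfolding valid_choice_def
      proof (intro allI impI)
        fix j assume "j < c"
        then show "?\<tau> (16 + j) \<in> {a j, b j}"
          using 1 assms(2) by (cases j "\<tau> 7" rule: linorder_cases) (auto simp: valid_choice_def)
      qed
      moreover have "layout k L c a b ?\<tau>" using lay True by (auto simp: layout_def)
      moreover have "\<tau> (\<tau> 5 + \<tau> 7) = b (\<tau> 7)" "\<tau> 6 = c" "\<tau> 5 = 16 + 2 * L"
        using lay True by (auto simp: layout_def)
      ultimately show ?thesis using True 1 W assms(4) by auto
    next
      case False
      \<comment> \<open>The carry ran past the last digit, so all digits were 1 and the counter
        overflows.\<close>
      let ?\<tau> = "\<tau>(11 := 0)"
      have "layout k L c a b ?\<tau>" "\<tau> 6 = c" using lay by (auto simp: layout_def)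
      moreover have "valid_choice c a b ?\<tau>" "chosen c b \<sigma> = {..<c}"
        using False 1 by (auto simp: valid_choice_def chosen_def)
      ultimately show ?thesis using False 1 W assms(4) by auto
    qed
  qed
  then show ?thesis using W assms(4) unfolding next_choice_def
    by (simp del: wp_If)
qed

text \<open>A choice given by its digit set alone, independent of the memory, so that statements can
  range over all \<open>2 ^ c\<close> choices.\<close>

definition select :: "(nat \<Rightarrow> nat) \<Rightarrow> (nat \<Rightarrow> nat) \<Rightarrow> nat set \<Rightarrow> nat \<Rightarrow> nat" where
  "select a b T i = (if i \<in> T then b i else a i)"

lemma select_chosen:
  "valid_choice c a b \<sigma> \<Longrightarrow> (\<lambda>i. \<sigma> (16 + i)) ` {..<c} = select a b (chosen c b \<sigma>) ` {..<c}"
  by (intro image_cong) (auto simp: valid_choice_def chosen_def select_def)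

lemma wp_search_loop:
  assumes "layout k L c a b \<sigma>" "\<forall>i<c. \<sigma> (16 + i) = a i" "\<forall>i<c. a i \<noteq> b i"
    "\<sigma> 11 = 1" "\<sigma> 12 = 0" "17 + 3 * L \<le> s" "s \<le> 2 ^ w"
  shows "wp s w search_loop (\<lambda>t \<tau>. t \<le> (2 ^ c + 1) * (250 * (c + 1)\<^sup>2) \<and> layout k L c a b \<tau> \<and>
    (\<tau> 12 = 1 \<and> valid_choice c a b \<tau> \<and> card ((\<lambda>i. \<tau> (16 + i)) ` {..<c}) \<le> k \<or>
     \<tau> 12 = 0 \<and> (\<forall>T\<subseteq>{..<c}. k < card (select a b T ` {..<c})))) \<sigma>"
proof -
  let ?b = "cell 11"
  \<comment> \<open>Progress of the search: all numbers below the current one are ruled out.\<close>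
  define R where "R \<rho> \<longleftrightarrow> (\<forall>T\<subseteq>{..<c}. set_encode T < set_encode (chosen c b \<rho>) \<longrightarrow>
      k < card (select a b T ` {..<c}))" for \<rho>
  \<comment> \<open>The three cases are a running search, success and exhaustion. In the last two
    the variant is free, as the loop test fails.\<close>
  define I where "I m \<rho> \<longleftrightarrow> layout k L c a b \<rho> \<and> valid_choice c a b \<rho> \<and>
    (\<rho> 11 = 1 \<and> \<rho> 12 = 0 \<and> m = 2 ^ c - set_encode (chosen c b \<rho>) \<and> R \<rho> \<or>
     \<rho> 11 = 0 \<and> \<rho> 12 = 1 \<and> card ((\<lambda>i. \<rho> (16 + i)) ` {..<c}) \<le> k \<or>
     \<rho> 11 = 0 \<and> \<rho> 12 = 0 \<and> (\<forall>T\<subseteq>{..<c}. k < card (select a b T ` {..<c})))" for m \<rho>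
  have W: "c \<le> L" "17 + 3 * L \<le> 2 ^ w" using assms by (auto simp: layout_def)
  have "wp s w search_loop (\<lambda>t \<tau>. t \<le> (2 ^ c + 1) * (250 * (c + 1)\<^sup>2) \<and>
      aval ?b \<tau> = 0 \<and> (\<exists>m. I m \<tau>)) \<sigma>"
    unfolding search_loop_def
  proof (rule wp_While)
    have "chosen c b \<sigma> = {}" using assms by (auto simp: chosen_def)
    then show "I (2 ^ c) \<sigma>" using assms by (auto simp: I_def R_def valid_choice_def)
    show "fits s w ?b \<rho>" if "I n \<rho>" for n \<rho>
      using W assms(6) by auto
    fix n \<rho> assume "I n \<rho>" and b: "aval ?b \<rho> \<noteq> 0"
    then have \<rho>: "layout k L c a b \<rho>" "valid_choice c a b \<rho>" "\<rho> 11 = 1" "\<rho> 12 = 0"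
      "n = 2 ^ c - set_encode (chosen c b \<rho>)" "R \<rho>" by (auto simp: I_def)
    have sub: "chosen c b \<rho> \<subseteq> {..<c}" by (auto simp: chosen_def)
    have n: "0 < n" using set_encode_less[OF sub] \<rho>(5) by simp
    let ?d = "card ((\<lambda>i. \<rho> (16 + i)) ` {..<c})"
    let ?Q = "\<lambda>t \<tau>. 1 + ops ?b + t \<le> 250 * (c + 1)\<^sup>2 \<and> I (n - 1) \<tau>"
    let ?If = "If (Bin Less (cell 2) (cell 9)) next_choice
              (Seq (set_cell 12 (Const 1)) (set_cell 11 (Const 0)))"
    have lay: "layout k L c a b (\<rho>(9 := 0, 7 := 0))" using \<rho>(1) by (auto simp: layout_def)
    note distinct = wp_distinct_loop[OF lay _ _ assms(6,7), simplified]
    have "wp s w distinct_loop (\<lambda>t. wp s w ?If (\<lambda>t'. ?Q (1 + 1 + 1 + (1 + 1 + 1 + (t + t'))))) (\<rho>(9 := 0, 7 := 0))"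
    proof (rule wp_mono[OF distinct], elim conjE exE, goal_cases)
      case (1 t \<rho>' x y)
      then have t: "t \<le> 20 * (c + 1)\<^sup>2 + 50 * (c + 1)"
        by (simp add: power2_eq_square algebra_simps)
      \<comment> \<open>Linear terms and constants are absorbed into the square; the total cost of a
        round then stays below the factor 250.\<close>
      have c2: "c + 1 \<le> (c + 1)\<^sup>2" by (simp add: power2_eq_square)
      have \<rho>': "\<rho>' = \<rho>(7 := x, 8 := y, 9 := ?d)" using 1 by (auto simp: fun_eq_iff)
      have lay': "layout k L c a b \<rho>'" "valid_choice c a b \<rho>'" "\<rho>' 2 = k" "\<rho>' 9 = ?d"
        "\<rho>' 11 = 1" "\<rho>' 12 = 0" "chosen c b \<rho>' = chosen c b \<rho>"
        using \<rho> \<rho>' by (auto simp: layout_def valid_choice_def chosen_def)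
      show ?case
      proof (cases "k < ?d")
        case True
        \<comment> \<open>A number below the successor is either smaller, and ruled out by
          \<open>R\<close>, or equal; then \<open>T\<close> is the current choice, as
          \<open>set_encode\<close> is injective on finite sets.\<close>
        have all: "k < card (select a b T ` {..<c})"
          if "T \<subseteq> {..<c}" "set_encode T < Suc (set_encode (chosen c b \<rho>))" for T
        proof (cases "T = chosen c b \<rho>")
          case True
          with \<open>k < ?d\<close> \<rho>(2) show ?thesis by (simp add: select_chosen)
        next
          case False
          with that sub have "set_encode T \<noteq> set_encode (chosen c b \<rho>)"
            by (metis finite_lessThan finite_subset set_encode_eq)
          with that \<rho>(6) show ?thesis by (auto simp: R_def)
        qed
        have "wp s w next_choice (\<lambda>t'. ?Q (1 + 1 + 1 + (1 + 1 + 1 + (t + (1 + ops (Bin Less (cell 2) (cell 9)) + t'))))) \<rho>'"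
        proof (rule wp_mono[OF wp_next_choice[OF lay'(1,2) assms(3,6,7)]], elim conjE, goal_cases)
          case (1 t' \<tau>)
          have "I (n - 1) \<tau>"
            using 1(5)
          proof (elim disjE conjE)
            assume "\<tau> 11 = \<rho>' 11"
              "set_encode (chosen c b \<tau>) = Suc (set_encode (chosen c b \<rho>'))"
            with 1 lay' \<rho> all show ?thesis by (auto simp: I_def R_def)
          next
            \<comment> \<open>On overflow the current number is \<open>2 ^ c - 1\<close>, so
              \<open>all\<close> covers every digit set.\<close>
            assume "\<tau> 11 = 0" "chosen c b \<rho>' = {..<c}"
            with 1 lay' all show ?thesis
              using set_encode_less set_encode_lessThan[of c] by (auto simp: I_def)
          qed
          with 1(1) t c2 show ?case by simp
        qed
        with True lay' W assms(6) show ?thesis by simp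
      next
        case False
        have "I (n - 1) (\<rho>'(12 := 1, 11 := 0))"
          using False lay' \<rho>' by (auto simp: I_def layout_def valid_choice_def)
        with False lay' t c2 W assms(6) show ?thesis by simp
      qed
    qed
    then show "0 < n \<and> wp s w (Seq (set_cell 9 (Const 0)) (Seq (set_cell 7 (Const 0))
        (Seq distinct_loop ?If))) ?Q \<rho>"
      using n W assms(6) by (simp del: wp_If)
  qed (simp add: power2_eq_square)
  then show ?thesis
    by (rule wp_mono) (auto simp: I_def)
qed

lemma wp_vc_query:
  assumes "layout k L c a b \<sigma>" "\<forall>i<c. \<sigma> (16 + i) = a i" "\<forall>i<c. a i \<noteq> b i"
    "17 + 3 * L \<le> s" "s \<le> 2 ^ w"
  shows "wp s w vc_query (\<lambda>t \<tau>. t \<le> 600 * 2 ^ c * (c + 1)\<^sup>2 \<and>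
    (\<tau> 0 = 1 \<and> \<tau> 1 = 16 \<and> \<tau> 2 = c \<and> valid_choice c a b \<tau> \<and>
       card ((\<lambda>i. \<tau> (16 + i)) ` {..<c}) \<le> k \<or>
     \<tau> 0 = 0 \<and> (\<forall>T\<subseteq>{..<c}. k < card (select a b T ` {..<c})))) \<sigma>"
    (is "wp s w _ ?Q _")
proof -
  have W: "c \<le> L" "17 + 3 * L \<le> 2 ^ w" using assms by (auto simp: layout_def)
  have "layout k L c a b (\<sigma>(12 := 0, 11 := 1))" using assms(1) by (auto simp: layout_def)
  note search = wp_search_loop[OF this _ assms(3) _ _ assms(4,5)]
  have "wp s w search_loop (\<lambda>t. wp s w (Seq (set_cell 0 (cell 12)) (Seq (set_cell 1 (Const 16))
         (set_cell 2 (cell 6)))) (\<lambda>t'. ?Q (1 + 1 + 1 + (1 + 1 + 1 + (t + t'))))) (\<sigma>(12 := 0, 11 := 1))"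
  proof (rule wp_mono[OF search], goal_cases)
    case (4 t \<tau>)
    \<comment> \<open>\<open>X\<close> dominates \<open>(c + 1)\<^sup>2\<close> and 1, so the search
      takes at most \<open>500 * X\<close> and the remaining writes fit into another
      \<open>100 * X\<close>.\<close>
    define X where "X = (2::nat) ^ c * (c + 1)\<^sup>2"
    have "(c + 1)\<^sup>2 \<le> X" "1 \<le> X" by (simp_all add: X_def)
    moreover have "(2 ^ c + 1) * (250 * (c + 1)\<^sup>2) = 250 * X + 250 * (c + 1)\<^sup>2"
      by (simp add: X_def algebra_simps)
    ultimately have "t + 20 \<le> 600 * 2 ^ c * (c + 1)\<^sup>2"
      using 4 unfolding mult.assoc X_def[symmetric] by linarith
    with 4 W assms(4) show ?case by (auto simp: layout_def valid_choice_def)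
  qed (use assms in auto)
  then show ?thesis using W assms(4) unfolding vc_query_def by simp
qed

section \<open>Counting degrees and inserting an edge\<close>

lemma card_less_Suc:
  "card {j. j < Suc i \<and> P j} = card {j. j < i \<and> P j} + (if P i then 1 else 0)"
proof -
  have "{j. j < Suc i \<and> P j} = (if P i then insert i else id) {j. j < i \<and> P j}"
    by (auto simp: less_Suc_eq)
  then show ?thesis by simp
qed

lemma card_less_le: "card {j. j < i \<and> P j} \<le> (i :: nat)"
  using card_mono[of "{..<i}" "{j. j < i \<and> P j}"] by auto

lemma incident:
  assumes "\<rho> 4 = 16 + L" "\<rho> 5 = 16 + 2 * L" "\<rho> 7 = i" "i < L"
    "\<rho> (16 + L + i) \<noteq> \<rho> (16 + 2 * L + i)" "x < 16" "17 + 3 * L \<le> s" "s \<le> 2 ^ w"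
  shows "aval (incident x) \<rho> = (if \<rho> x \<in> {\<rho> (16 + L + i), \<rho> (16 + 2 * L + i)} then 1 else 0)"
    and "fits s w (incident x) \<rho>"
  using assms by (auto simp: incident_def)

text \<open>The time of an update is not restricted, so the bound from \<open>wp_While\<close> only
  serves termination and is dropped.\<close>

lemma wp_count_loop:
  assumes "layout k L c a b \<sigma>" "\<forall>i<c. a i \<noteq> b i" "\<sigma> 0 = u" "\<sigma> 1 = v" "u \<noteq> v"
    "\<sigma> 7 = 0" "\<sigma> 9 = 0" "\<sigma> 10 = 0" "\<sigma> 11 = 0" and s: "17 + 3 * L \<le> s" "s \<le> 2 ^ w"
  shows "wp s w count_loop (\<lambda>t \<tau>. \<exists>x. \<tau> = \<sigma>(7 := x, 9 := card {i. i < c \<and> u \<in> {a i, b i}},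
    10 := card {i. i < c \<and> v \<in> {a i, b i}}, 11 := card {i. i < c \<and> {a i, b i} = {u, v}})) \<sigma>"
proof -
  let ?b = "Bin Less (cell 7) (cell 6)"
  define d where "d x i = card {j. j < i \<and> x \<in> {a j, b j}}" for x i
  define m where "m i = card {j. j < i \<and> {a j, b j} = {u, v}}" for i
  let ?\<sigma> = "\<lambda>i. \<sigma>(7 := i, 9 := d u i, 10 := d v i, 11 := m i)"
  define I where "I r \<rho> \<longleftrightarrow> (\<exists>i\<le>c. \<rho> = ?\<sigma> i \<and> r = c - i)" for r \<rho>
  have W: "c \<le> L" "17 + 3 * L \<le> 2 ^ w" and c: "\<sigma> 6 = c" using assms by (auto simp: layout_def)
  have "wp s w count_loop (\<lambda>t \<tau>. t \<le> (c + 1) * 200 \<and> aval ?b \<tau> = 0 \<and> (\<exists>r. I r \<tau>)) \<sigma>"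
    unfolding count_loop_def
  proof (rule wp_While)
    show "I c \<sigma>" unfolding I_def using assms
      by (intro exI[of _ 0] conjI) (auto simp: fun_eq_iff d_def m_def)
    show "fits s w ?b \<rho>" if "I n \<rho>" for n \<rho>
      using that W c s by (auto simp: I_def)
    fix n \<rho> assume "I n \<rho>" and b: "aval ?b \<rho> \<noteq> 0"
    then obtain i where i: "i \<le> c" "\<rho> = ?\<sigma> i" "n = c - i"
      by (auto simp: I_def)
    with b c have "i < c" by (auto split: if_splits)
    define e where "e x = (if x \<in> {a i, b i} then 1 else 0 :: nat)" for x
    have mem: "\<sigma> 4 = 16 + L" "\<sigma> 5 = 16 + 2 * L" "\<sigma> (16 + L + i) = a i" "\<sigma> (16 + 2 * L + i) = b i"
      using assms(1) \<open>i < c\<close> by (auto simp: layout_def)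
    have ab: "a i \<noteq> b i" using assms(2) \<open>i < c\<close> by blast
    have inc: "aval (incident x) (\<rho>(9 := y, 10 := z)) = e (\<sigma> x)"
      "fits s w (incident x) (\<rho>(9 := y, 10 := z))" if "x < 2" for x y z
    proof -
      note * = incident[of "\<rho>(9 := y, 10 := z)" L i x s w]
      show "aval (incident x) (\<rho>(9 := y, 10 := z)) = e (\<sigma> x)"
        by (subst *(1)) (use that i \<open>i < c\<close> mem ab W s in \<open>auto simp: e_def\<close>)
      show "fits s w (incident x) (\<rho>(9 := y, 10 := z))"
        by (rule *(2)) (use that i \<open>i < c\<close> mem ab W s in auto)
    qed
    \<comment> \<open>Trivial updates let the single fact \<open>inc\<close> cover all states in
      which the body evaluates \<open>incident\<close>.\<close>
    have upd: "\<rho>(9 := \<rho> 9, 10 := \<rho> 10) = \<rho>" "\<rho>(9 := y, 10 := \<rho> 10) = \<rho>(9 := y)" for y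
      by (auto simp: fun_eq_iff)
    note inc' = inc[of 0 "\<rho> 9" "\<rho> 10", unfolded upd] inc[of 1 "d u i + e u" "\<rho> 10", unfolded upd]
      inc[of 0 "d u i + e u" "d v i + e v"] inc[of 1 "d u i + e u" "d v i + e v"]
    have d: "d x (Suc i) = d x i + e x" for x
      by (simp add: d_def e_def card_less_Suc)
    \<comment> \<open>An edge incident with both of the distinct vertices \<open>u\<close> and
      \<open>v\<close> is the edge between them.\<close>
    have m: "m (Suc i) = m i + e u * e v"
      using ab \<open>u \<noteq> v\<close> by (auto simp: m_def e_def card_less_Suc doubleton_eq_iff)
    have le: "d x (Suc i) \<le> Suc i" "m (Suc i) \<le> Suc i" for x
      unfolding d_def m_def by (rule card_less_le)+
    have e: "e x \<le> 1" for x by (simp add: e_def)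
    have ee: "e u * e v \<le> 1" using mult_le_mono[OF e[of u] e[of v]] by simp
    have "I (n - 1) (?\<sigma> (Suc i))"
      unfolding I_def using i \<open>i < c\<close> by (intro exI[of _ "Suc i"]) auto
    moreover have "?\<sigma> (Suc i) = \<rho>(9 := d u i + e u, 10 := d v i + e v, 11 := m i + e u * e v, 7 := Suc i)"
      using i by (auto simp: fun_eq_iff d m)
    ultimately have I: "I (n - 1) (\<rho>(9 := d u i + e u, 10 := d v i + e v, 11 := m i + e u * e v, 7 := Suc i))"
      by metis
    have mem': "\<rho> 7 = i" "\<rho> 9 = d u i" "\<rho> 10 = d v i" "\<rho> 11 = m i" using i by auto
    have ops: "ops (incident x) = 19" for x by (simp add: incident_def)
    \<comment> \<open>Each counter is at most the number of edges scanned, hence at most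
      \<open>L\<close>, so no word overflows.\<close>
    have small: "d x i + e x < 2 ^ w" "e x < 2 ^ w" "m i + e u * e v < 2 ^ w" "e u * e v < 2 ^ w"
      "Suc i < 2 ^ w" for x
      using le(1)[of x] le(2) e[of x] ee W \<open>i < c\<close> unfolding d m by linarith+
    have room: "13 \<le> s" "13 \<le> (2::nat) ^ w" using s by linarith+
    have inc'': "aval (incident 0) \<rho> = e u" "fits s w (incident 0) \<rho>"
      "aval (incident (Suc 0)) (\<rho>(9 := d u i + e u)) = e v"
      "fits s w (incident (Suc 0)) (\<rho>(9 := d u i + e u))"
      "aval (incident 0) (\<rho>(9 := d u i + e u, 10 := d v i + e v)) = e u"
      "fits s w (incident 0) (\<rho>(9 := d u i + e u, 10 := d v i + e v))"
      "aval (incident (Suc 0)) (\<rho>(9 := d u i + e u, 10 := d v i + e v)) = e v"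
      "fits s w (incident (Suc 0)) (\<rho>(9 := d u i + e u, 10 := d v i + e v))"
      using inc' assms(3,4) by simp_all
    show "0 < n \<and> wp s w
     (Seq (set_cell 9 (Bin Add (cell 9) (incident 0)))
     (Seq (set_cell 10 (Bin Add (cell 10) (incident 1)))
     (Seq (set_cell 11 (Bin Add (cell 11) (Bin Mul (incident 0) (incident 1))))
          (set_cell 7 (Bin Add (cell 7) (Const 1))))))
       (\<lambda>t \<tau>. 1 + ops ?b + t \<le> 200 \<and> I (n - 1) \<tau>) \<rho>"
      using I i(3) \<open>i < c\<close> small room
      by (simp add: mem' inc'' ops)
  qed auto
  then show ?thesis
  proof (rule wp_mono, elim conjE exE)
    fix t \<tau> r
    assume "aval ?b \<tau> = 0" "I r \<tau>"
    with c have "\<tau> = ?\<sigma> c" by (auto simp: I_def split: if_splits)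
    then show "\<exists>x. \<tau> = \<sigma>(7 := x, 9 := card {i. i < c \<and> u \<in> {a i, b i}},
      10 := card {i. i < c \<and> v \<in> {a i, b i}}, 11 := card {i. i < c \<and> {a i, b i} = {u, v}})"
      unfolding d_def m_def by blast
  qed
qed

lemma wp_vc_update:
  assumes lay: "layout k L c a b \<sigma>" and P: "\<forall>i<c. \<sigma> (16 + i) = a i"
    and ab: "\<forall>i<c. a i \<noteq> b i" and uv: "\<sigma> 0 = u" "\<sigma> 1 = v" "u \<noteq> v"
    and s: "17 + 3 * L \<le> s" "s \<le> 2 ^ w"
  shows "wp s w vc_update (\<lambda>t \<tau>. \<exists>c' a' b'. layout k L c' a' b' \<tau> \<and> (\<forall>i<c'. \<tau> (16 + i) = a' i) \<and>
    (if card {i. i < c \<and> u \<in> {a i, b i}} \<le> k \<and> card {i. i < c \<and> v \<in> {a i, b i}} \<le> k \<and>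
        (\<forall>i<c. {a i, b i} \<noteq> {u, v}) \<and> c < L
     then c' = Suc c \<and> a' = a(c := u) \<and> b' = b(c := v)
     else c' = c \<and> a' = a \<and> b' = b)) \<sigma>"
    (is "wp s w _ ?Q _")
proof -
  let ?\<sigma> = "\<sigma>(7 := 0, 9 := 0, 10 := 0, 11 := 0)"
  let ?d = "\<lambda>x. card {i. i < c \<and> x \<in> {a i, b i}}"
  let ?m = "card {i. i < c \<and> {a i, b i} = {u, v}}"
  have W: "c \<le> L" "17 + 3 * L \<le> 2 ^ w" using assms by (auto simp: layout_def)
  have lay0: "layout k L c a b ?\<sigma>" using lay by (auto simp: layout_def)
  have m0: "?m = 0 \<longleftrightarrow> (\<forall>i<c. {a i, b i} \<noteq> {u, v})" by auto
  note count = wp_count_loop[OF lay0 ab _ _ uv(3) _ _ _ _ s]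
  let ?B = "Bin Mul (Bin Mul (Bin Eq (Bin Less (cell 2) (cell 9)) (Const 0))
                          (Bin Eq (Bin Less (cell 2) (cell 10)) (Const 0)))
                 (Bin Mul (Bin Eq (cell 11) (Const 0)) (Bin Less (cell 6) (cell 3)))"
  have "wp s w count_loop (\<lambda>t. wp s w (If ?B store_edge Skip) (\<lambda>t'. ?Q t')) ?\<sigma>"
  proof (rule wp_mono[OF count], goal_cases)
    case (7 t \<tau>)
    then obtain x where \<tau>: "\<tau> = \<sigma>(7 := x, 9 := ?d u, 10 := ?d v, 11 := ?m)"
      by (auto simp: fun_eq_iff)
    have mem: "\<tau> 0 = u" "\<tau> 1 = v" "\<tau> 2 = k" "\<tau> 3 = L" "\<tau> 4 = 16 + L" "\<tau> 5 = 16 + 2 * L" "\<tau> 6 = c"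
      "\<tau> 9 = ?d u" "\<tau> 10 = ?d v" "\<tau> 11 = ?m"
      using lay uv \<tau> by (auto simp: layout_def)
    have lay': "layout k L c a b \<tau>" and P': "\<forall>i<c. \<tau> (16 + i) = a i"
      using lay P \<tau> by (auto simp: layout_def)
    show ?case
    proof (cases "?d u \<le> k \<and> ?d v \<le> k \<and> ?m = 0 \<and> c < L")
      case True
      let ?\<tau> = "\<tau>(16 + c := u, 16 + L + c := u, 16 + 2 * L + c := v, 6 := Suc c)"
      have "layout k L (Suc c) (a(c := u)) (b(c := v)) ?\<tau>"
        using lay' True by (auto simp: layout_def less_Suc_eq)
      moreover have "\<forall>i<Suc c. ?\<tau> (16 + i) = (a(c := u)) i"
        using P' True by (auto simp: less_Suc_eq)
      ultimately have "\<exists>c' a' b'. layout k L c' a' b' ?\<tau> \<and> (\<forall>i<c'. ?\<tau> (16 + i) = a' i) \<and>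
         c' = Suc c \<and> a' = a(c := u) \<and> b' = b(c := v)" by blast
      with True W s mem m0 show ?thesis by (simp add: store_edge_def)
    next
      case False
      have "\<exists>c' a' b'. layout k L c' a' b' \<tau> \<and> (\<forall>i<c'. \<tau> (16 + i) = a' i) \<and>
         c' = c \<and> a' = a \<and> b' = b" using lay' P' by blast
      moreover have "\<not> (?d u \<le> k \<and> ?d v \<le> k \<and> (\<forall>i<c. {a i, b i} \<noteq> {u, v}) \<and> c < L)"
        using False m0 by blast
      moreover have "fits s w ?B \<tau>" "aval ?B \<tau> = 0" using False mem W s by auto
      ultimately show ?thesis by (simp only: wp_If wp_Skip simp_thms if_False)
    qed
  qed (use assms in auto)
  then show ?thesis using W s unfolding vc_update_def by (simp del: wp_If)
qed


section \<open>The kernel\<close>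

text \<open>As stored edges belong to \<open>G\<close>, the last conjunct means that they have the
  same covers of size at most \<open>k\<close> as \<open>G\<close>. The degree cap is
  \<open>k + 1\<close> because a vertex is forced into such a cover only once its degree exceeds
  \<open>k\<close>.\<close>

definition kernel ::
  "nat \<Rightarrow> nat \<Rightarrow> nat set set \<Rightarrow> nat \<Rightarrow> (nat \<Rightarrow> nat) \<Rightarrow> (nat \<Rightarrow> nat) \<Rightarrow> bool" where
  "kernel n k G c a b \<longleftrightarrow>
     (\<forall>i<c. a i \<noteq> b i \<and> a i < n \<and> b i < n \<and> {a i, b i} \<in> G) \<and>
     inj_on (\<lambda>i. {a i, b i}) {..<c} \<and>
     (\<forall>x. card {i. i < c \<and> x \<in> {a i, b i}} \<le> k + 1) \<and>
     (\<forall>C. finite C \<and> card C \<le> k \<and> (\<forall>i<c. a i \<in> C \<or> b i \<in> C) \<longrightarrow> (\<forall>e\<in>G. e \<inter> C \<noteq> {}))"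

text \<open>A vertex outside \<open>C\<close> forces all its neighbours into \<open>C\<close>.
  Injectivity makes them distinct, so there would be more than \<open>k\<close> of them.\<close>

lemma high_degree_in_cover:
  assumes inj: "inj_on (\<lambda>i. {a i, b i}) {..<c}" and C: "finite C" "card C \<le> k"
    and cov: "\<forall>i<c. a i \<in> C \<or> b i \<in> C" and deg: "k < card {i. i < c \<and> x \<in> {a i, b i}}"
  shows "x \<in> C"
proof (rule ccontr)
  assume x: "x \<notin> C"
  let ?D = "{i. i < c \<and> x \<in> {a i, b i}}"
  let ?g = "\<lambda>i. if a i = x then b i else a i"
  have "inj_on ?g ?D"
  proof (rule inj_onI)
    fix i j assume ij: "i \<in> ?D" "j \<in> ?D" "?g i = ?g j"
    have "{a i, b i} = {x, ?g i}" using ij(1) by auto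
    also have "\<dots> = {x, ?g j}" by (rule arg_cong[OF ij(3)])
    also have "\<dots> = {a j, b j}" using ij(2) by auto
    finally have "{a i, b i} = {a j, b j}" .
    with inj ij show "i = j" by (auto dest: inj_onD)
  qed
  moreover have "?g ` ?D \<subseteq> C" using cov x by auto
  ultimately have "card ?D \<le> card C" using C(1) card_inj_on_le by blast
  with deg C(2) show False by simp
qed

lemma cover_bounds_edges:
  assumes "finite C" "card C \<le> k" "\<forall>i<c. a i \<in> C \<or> b i \<in> C"
    and deg: "\<forall>x. card {i. i < c \<and> x \<in> {a i, b i}} \<le> k + 1"
  shows "c \<le> k * (k + 1)"
proof -
  have "{..<c} \<subseteq> (\<Union>x\<in>C. {i. i < c \<and> x \<in> {a i, b i}})" using assms(3) by auto
  then have "card {..<c} \<le> card (\<Union>x\<in>C. {i. i < c \<and> x \<in> {a i, b i}})"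
    using assms(1) by (intro card_mono) auto
  also have "\<dots> \<le> (\<Sum>x\<in>C. card {i. i < c \<and> x \<in> {a i, b i}})"
    by (rule card_UN_le[OF assms(1)])
  also have "\<dots> \<le> (\<Sum>x\<in>C. k + 1)" using deg by (intro sum_mono) blast
  also have "\<dots> \<le> k * (k + 1)" using mult_le_mono1[OF assms(2), of "k + 1"] by simp
  finally show ?thesis by simp
qed

lemma kernel_skip:
  assumes ker: "kernel n k G c a b"
    and skip: "k < card {i. i < c \<and> u \<in> {a i, b i}} \<or> k < card {i. i < c \<and> v \<in> {a i, b i}} \<or>
      (\<exists>i<c. {a i, b i} = {u, v}) \<or> k * (k + 1) < c"
  shows "kernel n k (insert {u, v} G) c a b"
proof -
  have "{u, v} \<inter> C \<noteq> {}" if C: "finite C" "card C \<le> k" "\<forall>i<c. a i \<in> C \<or> b i \<in> C" for C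
    using skip
  proof (elim disjE)
    assume "\<exists>i<c. {a i, b i} = {u, v}"
    then obtain i where "i < c" "{a i, b i} = {u, v}" by blast
    with C(3) show ?thesis by blast
  next
    \<comment> \<open>A full sketch admits no such \<open>C\<close>, so this case is
      contradictory.\<close>
    assume "k * (k + 1) < c"
    with cover_bounds_edges[OF C] ker show ?thesis by (auto simp: kernel_def)
  qed (use ker high_degree_in_cover[OF _ C] in \<open>auto simp: kernel_def\<close>)
  with ker show ?thesis by (simp add: kernel_def)
qed

text \<open>Only \<open>u\<close> and \<open>v\<close> gain degree, and both had room. A small cover
  of the extended list covers the old list, hence \<open>G\<close>, and the new edge as
  well.\<close>

lemma kernel_store:
  assumes ker: "kernel n k G c a b" and uv: "u \<noteq> v" "u < n" "v < n"
    and deg: "card {i. i < c \<and> u \<in> {a i, b i}} \<le> k" "card {i. i < c \<and> v \<in> {a i, b i}} \<le> k"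
    and new: "\<forall>i<c. {a i, b i} \<noteq> {u, v}"
  shows "kernel n k (insert {u, v} G) (Suc c) (a(c := u)) (b(c := v))"
proof -
  let ?a = "a(c := u)" and ?b = "b(c := v)"
  have old: "{i. i < c \<and> x \<in> {?a i, ?b i}} = {i. i < c \<and> x \<in> {a i, b i}}" for x by auto
  have "inj_on (\<lambda>i. {?a i, ?b i}) {..<Suc c}"
  proof (rule inj_onI)
    fix i j assume "i \<in> {..<Suc c}" "j \<in> {..<Suc c}" "{?a i, ?b i} = {?a j, ?b j}"
    moreover have "inj_on (\<lambda>i. {a i, b i}) {..<c}" using ker by (simp add: kernel_def)
    ultimately show "i = j"
      using new by (cases "i = c"; cases "j = c") (auto simp: less_Suc_eq dest: inj_onD)
  qed
  moreover have "card {i. i < Suc c \<and> x \<in> {?a i, ?b i}} \<le> k + 1" for x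
  proof (cases "x \<in> {u, v}")
    case True
    then show ?thesis unfolding card_less_Suc old using deg by auto
  next
    case False
    moreover have "card {i. i < c \<and> x \<in> {a i, b i}} \<le> k + 1" using ker unfolding kernel_def by blast
    ultimately show ?thesis unfolding card_less_Suc old by auto
  qed
  moreover have "\<forall>e\<in>insert {u, v} G. e \<inter> C \<noteq> {}"
    if C: "finite C" "card C \<le> k" "\<forall>i<Suc c. ?a i \<in> C \<or> ?b i \<in> C" for C
  proof -
    have "a i \<in> C \<or> b i \<in> C" if "i < c" for i using C(3)[rule_format, of i] that by simp
    with ker C(1,2) have "\<forall>e\<in>G. e \<inter> C \<noteq> {}" unfolding kernel_def by blast
    with C(3)[rule_format, of c] show ?thesis by auto
  qed
  ultimately show ?thesis using ker uv by (auto simp: kernel_def less_Suc_eq)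
qed

lemma select_is_cover:
  assumes "kernel n k G c a b" "\<forall>i<c. p i \<in> {a i, b i}" "card (p ` {..<c}) \<le> k"
  shows "vertex_cover {..<n} G (p ` {..<c})"
proof -
  have "\<forall>i<c. a i \<in> p ` {..<c} \<or> b i \<in> p ` {..<c}"
    using assms(2) by (metis image_eqI insertE lessThan_iff singletonD)
  with assms(1,3) have "\<forall>e\<in>G. e \<inter> p ` {..<c} \<noteq> {}" unfolding kernel_def by blast
  moreover have "p ` {..<c} \<subseteq> {..<n}" using assms(1,2) by (fastforce simp: kernel_def)
  ultimately show ?thesis by (simp add: vertex_cover_def)
qed

text \<open>A cover \<open>X\<close> guides a choice: take the second end point where it lies in
  \<open>X\<close>, otherwise the first, which must then lie in \<open>X\<close>. The chosen
  vertices form a subset of \<open>X\<close>.\<close>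

lemma no_cover_if_no_selection:
  assumes "kernel n k G c a b" "\<forall>T\<subseteq>{..<c}. k < card (select a b T ` {..<c})"
    "vertex_cover {..<n} G X" "finite X"
  shows "k < card X"
proof -
  let ?T = "{i. i < c \<and> b i \<in> X}"
  have "select a b ?T ` {..<c} \<subseteq> X"
    using assms(1,3) by (auto simp: select_def kernel_def vertex_cover_def)
  then have "card (select a b ?T ` {..<c}) \<le> card X" using assms(4) by (rule card_mono[rotated])
  moreover have "k < card (select a b ?T ` {..<c})" by (rule assms(2)[rule_format]) auto
  ultimately show ?thesis by simp
qed


section \<open>The streaming algorithm\<close>

definition vc_alg :: stream_alg where
  "vc_alg = \<lparr>init = vc_init, update = vc_update, query = vc_query\<rparr>"

lemma edges_snoc: "edges (S @ [(u, v)]) = insert {u, v} (edges S)"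
  by (auto simp: edges_def)

text \<open>Induction at the right end of the stream matches \<open>sketch\<close>.
  \<open>is_mem\<close> is carried along because the next insertion requires it;
  \<open>n < 2 ^ w\<close> lets vertex names fit into the input ports.\<close>

lemma ex_sketch:
  assumes "edge_stream n S" "L = k * k + k + 1" "17 + 3 * L \<le> s" "s \<le> 2 ^ w" "n < 2 ^ w"
  shows "\<exists>\<sigma> c a b. sketch s w vc_alg n k S \<sigma> \<and> is_mem s w \<sigma> \<and> layout k L c a b \<sigma> \<and>
    (\<forall>i<c. \<sigma> (16 + i) = a i) \<and> kernel n k (edges S) c a b"
  using assms(1)
proof (induction S rule: rev_induct)
  case Nil
  let ?\<sigma> = "(\<lambda>_. 0)(0 := n, 1 := k) :: mem"
  have mem: "is_mem s w ?\<sigma>" using assms(2-5) by (auto simp: is_mem_def)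
  have "wp s w vc_init (\<lambda>t \<tau>. layout k L 0 id id \<tau>) ?\<sigma>"
    unfolding vc_init_def using assms(2-4) by (auto simp: layout_def)
  then obtain t \<tau> where \<tau>: "exec s w vc_init ?\<sigma> t \<tau>" "layout k L 0 id id \<tau>"
    unfolding wp_def by blast
  have "sketch s w vc_alg n k [] \<tau>"
    by (rule sketch.start[OF refl mem]) (use \<tau> in \<open>simp add: vc_alg_def\<close>)
  moreover have "kernel n k (edges []) 0 id id" by (simp add: kernel_def edges_def)
  ultimately show ?case using \<tau> exec_is_mem[OF \<tau>(1) mem] by (metis not_less_zero)
next
  case (snoc e S)
  obtain u v where e: "e = (u, v)" by (cases e)
  have uv: "u < n" "v < n" "u \<noteq> v" and "edge_stream n S"
    using snoc.prems e by (auto simp: edge_stream_def)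
  with snoc.IH obtain \<sigma> c a b where \<sigma>: "sketch s w vc_alg n k S \<sigma>" "is_mem s w \<sigma>"
    "layout k L c a b \<sigma>" "\<forall>i<c. \<sigma> (16 + i) = a i" "kernel n k (edges S) c a b" by blast
  let ?\<sigma> = "\<sigma>(0 := u, 1 := v)"
  have mem: "is_mem s w ?\<sigma>" using \<sigma>(2) uv assms(3,5) by (auto simp: is_mem_def)
  have "layout k L c a b ?\<sigma>" "\<forall>i<c. ?\<sigma> (16 + i) = a i" "\<forall>i<c. a i \<noteq> b i"
    using \<sigma> by (auto simp: layout_def kernel_def)
  from wp_vc_update[OF this _ _ uv(3) assms(3,4)]
  obtain t \<tau> c' a' b' where \<tau>: "exec s w vc_update ?\<sigma> t \<tau>" "layout k L c' a' b' \<tau>"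
    "\<forall>i<c'. \<tau> (16 + i) = a' i"
    "if card {i. i < c \<and> u \<in> {a i, b i}} \<le> k \<and> card {i. i < c \<and> v \<in> {a i, b i}} \<le> k \<and>
        (\<forall>i<c. {a i, b i} \<noteq> {u, v}) \<and> c < L
     then c' = Suc c \<and> a' = a(c := u) \<and> b' = b(c := v)
     else c' = c \<and> a' = a \<and> b' = b"
    unfolding wp_def by auto
  have "kernel n k (edges (S @ [e])) c' a' b'"
  proof (cases "card {i. i < c \<and> u \<in> {a i, b i}} \<le> k \<and> card {i. i < c \<and> v \<in> {a i, b i}} \<le> k \<and>
        (\<forall>i<c. {a i, b i} \<noteq> {u, v}) \<and> c < L")
    case True
    with \<tau>(4) kernel_store[OF \<sigma>(5) uv(3,1,2)] show ?thesis unfolding e edges_snoc by presburger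
  next
    case False
    \<comment> \<open>\<open>L\<close> exceeds \<open>k * (k + 1)\<close> by one, so lack of room
      means precisely that there are too many edges for \<open>k\<close> vertices to cover.\<close>
    have full: "c < L \<longleftrightarrow> \<not> k * (k + 1) < c" using assms(2) by auto
    have dup: "(\<forall>i<c. {a i, b i} \<noteq> {u, v}) \<longleftrightarrow> \<not> (\<exists>i<c. {a i, b i} = {u, v})" by simp
    have "k < card {i. i < c \<and> u \<in> {a i, b i}} \<or> k < card {i. i < c \<and> v \<in> {a i, b i}} \<or>
      (\<exists>i<c. {a i, b i} = {u, v}) \<or> k * (k + 1) < c"
      using False unfolding dup full by (simp only: de_Morgan_conj not_le not_not)
    then have "kernel n k (insert {u, v} (edges S)) c a b"
      by (rule kernel_skip[OF \<sigma>(5)])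
    with False \<tau>(4) show ?thesis unfolding e edges_snoc by presburger
  qed
  moreover have "sketch s w vc_alg n k (S @ [e]) \<tau>"
    unfolding e by (rule sketch.insert[OF \<sigma>(1) refl mem]) (use \<tau> in \<open>simp add: vc_alg_def\<close>)
  ultimately show ?case using \<tau> exec_is_mem[OF \<tau>(1) mem] by blast
qed

lemma vc_query_correct:
  assumes lay: "layout k L c a b \<sigma>" "\<forall>i<c. \<sigma> (16 + i) = a i"
    and ker: "kernel n k G c a b" and s: "17 + 3 * L \<le> s" "s \<le> 2 ^ w"
  shows "\<exists>t \<tau>. exec s w vc_query \<sigma> t \<tau> \<and> t \<le> 600 * 2 ^ L * (L + 1)\<^sup>2 \<and>
    correct_answer vertex_cover s k {..<n} G \<tau>"
proof -
  have c: "c \<le> L" and "\<forall>i<c. a i \<noteq> b i" using lay ker by (auto simp: layout_def kernel_def)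
  from wp_vc_query[OF lay this(2) s] obtain t \<tau> where \<tau>: "exec s w vc_query \<sigma> t \<tau>"
    "t \<le> 600 * 2 ^ c * (c + 1)\<^sup>2"
    "\<tau> 0 = 1 \<and> \<tau> 1 = 16 \<and> \<tau> 2 = c \<and> valid_choice c a b \<tau> \<and>
       card ((\<lambda>i. \<tau> (16 + i)) ` {..<c}) \<le> k \<or>
     \<tau> 0 = 0 \<and> (\<forall>T\<subseteq>{..<c}. k < card (select a b T ` {..<c}))"
    unfolding wp_def by blast
  have "600 * 2 ^ c * (c + 1)\<^sup>2 \<le> 600 * 2 ^ L * (L + 1)\<^sup>2"
    using c by (intro mult_le_mono power_mono power_increasing) auto
  moreover from \<tau>(3) have "correct_answer vertex_cover s k {..<n} G \<tau>"
  proof (elim disjE conjE)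
    assume *: "\<tau> 0 = 1" "\<tau> 1 = 16" "\<tau> 2 = c" "valid_choice c a b \<tau>"
      "card ((\<lambda>i. \<tau> (16 + i)) ` {..<c}) \<le> k"
    have "{16..<16 + c} = (\<lambda>i. 16 + i) ` {..<c}"
      by (simp add: lessThan_atLeast0 add.commute)
    then have "\<tau> ` {16..<16 + c} = (\<lambda>i. \<tau> (16 + i)) ` {..<c}" by (simp only: image_image)
    moreover have "vertex_cover {..<n} G ((\<lambda>i. \<tau> (16 + i)) ` {..<c})"
      by (rule select_is_cover[OF ker _ *(5)]) (use *(4) in \<open>simp add: valid_choice_def\<close>)
    ultimately show ?thesis using * c s(1) by (simp add: correct_answer_def answer_def)
  next
    assume *: "\<tau> 0 = 0" "\<forall>T\<subseteq>{..<c}. k < card (select a b T ` {..<c})"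
    with no_cover_if_no_selection[OF ker *(2)] show ?thesis
      by (auto simp: correct_answer_def answer_def not_le)
  qed
  ultimately show ?thesis using \<tau>(1,2) le_trans by blast
qed

text \<open>The factor \<open>d\<close> in the number of bits becomes an exponent, so words can hold
  addresses polynomial in \<open>n + k\<close>.\<close>

lemma word_len_ge: "(n + k + 2) ^ d \<le> 2 ^ word_len d n k"
proof -
  let ?m = "n + k + 2"
  have "real ?m = 2 powr log 2 (real ?m)" by simp
  also have "\<dots> \<le> 2 powr real (nat \<lceil>log 2 (real ?m)\<rceil>)"
    by (intro powr_mono real_nat_ceiling_ge) auto
  also have "\<dots> = real (2 ^ nat \<lceil>log 2 (real ?m)\<rceil>)" by (subst powr_realpow) auto
  finally have "?m \<le> 2 ^ nat \<lceil>log 2 (real ?m)\<rceil>" by (simp only: of_nat_le_iff)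
  then have "?m ^ d \<le> (2 ^ nat \<lceil>log 2 (real ?m)\<rceil>) ^ d" by (rule power_mono) simp
  then show ?thesis by (simp add: word_len_def power_mult[symmetric] mult.commute)
qed

text \<open>Up to a factor 2, replacing the exponent \<open>L\<close> by
  \<open>2 * k\<^sup>2\<close> gains \<open>2 ^ (k\<^sup>2 - k)\<close>, which absorbs the
  polynomial. The constant 16 is forced by \<open>k = 1\<close>, where the auxiliary inequality is
  an equality.\<close>

lemma query_time_le:
  fixes k :: nat
  assumes "L = k * k + k + 1"
  shows "2 ^ L * (L + 1)\<^sup>2 \<le> 32 * 2 ^ (2 * k ^ 2)"
proof -
  have "(k * k + k + 2)\<^sup>2 \<le> 16 * 2 ^ (k * k - k)"
  proof (induction k)
    case (Suc k)
    show ?case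
    proof (cases "k = 0")
      case False
      \<comment> \<open>The base at most doubles, and \<open>2 \<le> 2 ^ k\<close> for positive
        \<open>k\<close>; squaring gives \<open>2 ^ (2 * k)\<close>, exactly the growth of
        \<open>2 ^ (k * k - k)\<close>.\<close>
      then have "Suc k * Suc k + Suc k + 2 \<le> 2 * (k * k + k + 2)" by (cases k) auto
      also have "\<dots> \<le> 2 ^ k * (k * k + k + 2)"
        using False by (intro mult_le_mono1 self_le_power) auto
      finally have "(Suc k * Suc k + Suc k + 2)\<^sup>2 \<le> (2 ^ k)\<^sup>2 * (k * k + k + 2)\<^sup>2"
        unfolding power_mult_distrib[symmetric] by (rule power_mono) simp
      also have "\<dots> \<le> (2 ^ k)\<^sup>2 * (16 * 2 ^ (k * k - k))" using Suc.IH by (rule mult_le_mono2)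
      also have "\<dots> = 16 * 2 ^ (k * 2 + (k * k - k))"
        unfolding power_add power_mult by (rule mult.left_commute)
      also have "k * 2 + (k * k - k) = Suc k * Suc k - Suc k"
        by (cases k) auto
      finally show ?thesis .
    qed (simp add: power2_eq_square)
  qed (simp add: power2_eq_square)
  then have "2 ^ L * (L + 1)\<^sup>2 \<le> 2 ^ L * (16 * 2 ^ (k * k - k))"
    using assms by (intro mult_le_mono2) (simp add: numeral_2_eq_2)
  also have "\<dots> = 16 * 2 ^ (L + (k * k - k))"
    unfolding power_add by (rule mult.left_commute)
  also have "L + (k * k - k) = 2 * k ^ 2 + 1"
    using assms by (cases k) (auto simp: power2_eq_square)
  finally show ?thesis by simp
qed

theorem theorem1:
  "\<exists>A. is_PSA (\<lambda>k. real (k ^ 2)) (\<lambda>k. 2 ^ (2 * k ^ 2)) vertex_cover A"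
\<comment> \<open>\<open>19200\<close> is \<open>600 * 32\<close>, the constants of the query and of
  \<open>query_time_le\<close>. Exponent 0 means that no logarithmic factor is needed.\<close>
proof (intro exI[of _ vc_alg], unfold is_PSA_def, rule exI[of _ 19200], rule exI[of _ 0],
    rule exI[of _ 5], intro allI impI)
  fix n k S assume S: "edge_stream n S"
  define w where "w = word_len 5 n k"
  define L where "L = k * k + k + 1"
  define s where "s = 17 + 3 * L"
  let ?m = "card (edges S)"
  \<comment> \<open>Five suffices as word length factor: \<open>s\<close> is at most
    \<open>8 * (k + 2)\<^sup>2\<close>, and \<open>(k + 2) ^ 3\<close> is at least 8.\<close>
  have "(k + 2) ^ 5 = (k + 2) ^ 2 * (k + 2) ^ 3"
    by (simp add: power_add[symmetric])
  moreover have "(k + 2) ^ 2 * 2 ^ 3 \<le> (k + 2) ^ 2 * (k + 2) ^ 3"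
    by (intro mult_le_mono2 power_mono) auto
  moreover have "s \<le> (k + 2) ^ 2 * 2 ^ 3"
    by (simp add: s_def L_def power2_eq_square algebra_simps)
  moreover have "(k + 2) ^ 5 \<le> (n + k + 2) ^ 5" by (intro power_mono) auto
  ultimately have sw: "s \<le> 2 ^ w" using word_len_ge[of n k 5] unfolding w_def by linarith
  have "n + k + 2 \<le> (n + k + 2) ^ 5" by (rule self_le_power) auto
  then have nw: "n < 2 ^ w" using word_len_ge[of n k 5] unfolding w_def by linarith
  have "real s \<le> soft_bound 19200 0 (real (k ^ 2)) ?m"
  proof -
    have "k \<le> k\<^sup>2" by (simp add: power2_eq_square)
    moreover have "s = 20 + 3 * k\<^sup>2 + 3 * k" by (simp add: s_def L_def power2_eq_square)
    ultimately have "s \<le> 20 + 6 * k\<^sup>2" by linarith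
    then have "real s \<le> real (20 + 6 * k\<^sup>2)" by (simp only: of_nat_le_iff)
    then show ?thesis by (simp add: soft_bound_def max_def)
  qed
  moreover have "\<exists>\<sigma> t \<tau>. sketch s w vc_alg n k (take i S) \<sigma> \<and> exec s w (query vc_alg) \<sigma> t \<tau> \<and>
      real t \<le> soft_bound 19200 0 (2 ^ (2 * k ^ 2)) ?m \<and>
      correct_answer vertex_cover s k {..<n} (edges (take i S)) \<tau>" for i
  proof -
    have "edge_stream n (take i S)" using S by (auto simp: edge_stream_def dest: in_set_takeD)
    from ex_sketch[OF this L_def _ sw nw] obtain \<sigma> c a b where
      \<sigma>: "sketch s w vc_alg n k (take i S) \<sigma>" "layout k L c a b \<sigma>" "\<forall>i<c. \<sigma> (16 + i) = a i"
        "kernel n k (edges (take i S)) c a b" by (auto simp: s_def)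
    from vc_query_correct[OF \<sigma>(2-4) _ sw] obtain t \<tau> where
      \<tau>: "exec s w vc_query \<sigma> t \<tau>" "t \<le> 600 * 2 ^ L * (L + 1)\<^sup>2"
        "correct_answer vertex_cover s k {..<n} (edges (take i S)) \<tau>" by (auto simp: s_def)
    have "t \<le> 19200 * 2 ^ (2 * k ^ 2)" using \<tau>(2) query_time_le[OF L_def] by simp
    then have "real t \<le> real (19200 * 2 ^ (2 * k ^ 2))" by (simp only: of_nat_le_iff)
    then have "real t \<le> soft_bound 19200 0 (2 ^ (2 * k ^ 2)) ?m"
      by (simp add: soft_bound_def max_def)
    with \<sigma>(1) \<tau> show ?thesis by (auto simp: vc_alg_def)
  qed
  ultimately show "let m = card (edges S); w = word_len 5 n k in
        \<exists>s. real s \<le> soft_bound 19200 0 (real (k ^ 2)) m \<and>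
          (\<forall>i\<le>length S. \<exists>\<sigma> t \<tau>.
             sketch s w vc_alg n k (take i S) \<sigma> \<and>
             exec s w (query vc_alg) \<sigma> t \<tau> \<and>
             real t \<le> soft_bound 19200 0 (2 ^ (2 * k ^ 2)) m \<and>
             correct_answer vertex_cover s k {..<n} (edges (take i S)) \<tau>)"
    unfolding Let_def w_def by blast
qed

end
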